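(* Let $d$ be a positive integer and let $C\subset\mathbb{R}^d$ be a simple closed curve. (Version 1) At most two of the $d$ coordinate shadows of $C$ are simple paths; that is, there are at most two indices $i\in\{1,\dots,d\}$ such that $\pi_i(C)$ is a simple path. (Version 2, a restatement up to linear transformations) There do not exist three linearly independent vectors $v_1,v_2,v_3\in\mathbb{R}^d$ such that for each $j\in\{1,2,3\}$ the image of $C$ under the orthogonal projection of $\mathbb{R}^d$ onto the hyperplane orthogonal to $v_j$ is a simple path.
   Context: A simple closed curve in $\mathbb{R}^d$ is the image of an injective continuous map $\gamma:\mathbb{S}^1\to\mathbb{R}^d$ (a topological embedding of the circle). A simple path is a set homeomorphic to the closed unit interval $[0,1]$, i.e. the image of an injective continuous map from $[0,1]$. For $i\in\{1,\dots,d\}$, $\pi_i:\mathbb{R}^d\to\{(x_1,\dots,x_d)\in\mathbb{R}^d : x_i=0\}$ denotes the orthogonal projection onto the $i$-th coordinate hyperplane, and the $i$-th coordinate shadow of a set $A\subset\mathbb{R}^d$ is $\pi_i(A)$. *)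

theory Defs
  imports "HOL-Analysis.Analysis"
begin

definition simple_closed_curve :: "'a::topological_space set \<Rightarrow> bool" where
  "simple_closed_curve C \<longleftrightarrow>
     (\<exists>\<gamma> :: complex \<Rightarrow> 'a. continuous_on (sphere 0 1) \<gamma> \<and> inj_on \<gamma> (sphere 0 1)
        \<and> C = \<gamma> ` sphere 0 1)"

(* A set, not a parametrization. In particular it differs from the library constant simple_path,
   which also admits closed paths; the injective notion is called arc there. *)
definition is_simple_path :: "'a::topological_space set \<Rightarrow> bool" where
  "is_simple_path A \<longleftrightarrow> (\<exists>g. arc g \<and> A = path_image g)"

(* Meaningful when S is a linear subspace, where such a y exists and is unique. *)
definition orth_proj :: "'a::euclidean_space set \<Rightarrow> 'a \<Rightarrow> 'a" where
  "orth_proj S x = (THE y. y \<in> S \<and> x - y \<in> orthogonal_comp S)"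

definition coord_proj :: "'n::finite \<Rightarrow> real ^ 'n \<Rightarrow> real ^ 'n" where
  "coord_proj i = orth_proj {x. x $ i = 0}"

lemma orth_proj_eqI:
  assumes S: "subspace S" and y: "y \<in> S" "x - y \<in> orthogonal_comp S"
  shows "orth_proj S x = y"
  unfolding orth_proj_def
proof (rule the_equality)
  show "y \<in> S \<and> x - y \<in> orthogonal_comp S" using y by simp
next
  fix z assume z: "z \<in> S \<and> x - z \<in> orthogonal_comp S"
  have "z - y \<in> S" using S z y by (simp add: subspace_diff)
  then have "(z - y) \<bullet> (x - y) = 0" "(z - y) \<bullet> (x - z) = 0"
    using y z by (auto simp: orthogonal_comp_def orthogonal_def)
  then have "(z - y) \<bullet> (z - y) = 0" by (simp add: inner_diff_right)
  then show "z = y" by simp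
qed

lemma orth_proj_hyperplane:
  assumes "v \<noteq> 0"
  shows "orth_proj (orthogonal_comp {v}) x = x - ((x \<bullet> v) / (v \<bullet> v)) *\<^sub>R v"
proof (rule orth_proj_eqI)
  show "subspace (orthogonal_comp {v})" by (rule subspace_orthogonal_comp)
qed (use assms in \<open>auto simp: orthogonal_comp_def orthogonal_def inner_diff_right inner_commute\<close>)

lemma coord_proj_component:
  fixes x :: "real ^ 'n"
  shows "coord_proj i x = (\<chi> j. if j = i then 0 else x $ j)"
  unfolding coord_proj_def
proof (rule orth_proj_eqI)
  show "subspace {x :: real ^ 'n. x $ i = 0}" by (auto simp: subspace_def)
next
  show "x - (\<chi> j. if j = i then 0 else x $ j) \<in> orthogonal_comp {x. x $ i = 0}"
    by (auto simp: orthogonal_comp_def orthogonal_def inner_vec_def intro!: sum.neutral)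
qed simp

end

(* Parametrise the curve with period 1. A direction v gives a position function f along its arc
   shadow and the coordinate x along v. Each x is a function of the f of every other direction, two
   different f separate points, and (f, x) for one direction separates points. If an arc {u..v} of
   the curve joins an extreme point of f j to an extreme point of f k, j \<noteq> k, every level set of the
   third coordinate x i meets it: otherwise f j and f k would both agree at the two ends of the gap of
   the level set around {u..v}. Take such an arc containing no extreme point of f i. It carries both
   extremes of x i while the complementary arc carries both extremes of f i, so by the Fashoda
   theorem the injective planar curve (f i, x i) crosses itself. *)
theory Submission
  imports Defs
begin

section \<open>Periodic functions on the line\<close>

lemma IVT_between:
  fixes f :: "real \<Rightarrow> real"
  assumes "continuous_on UNIV f" "p \<le> q" "f p \<le> c \<and> c \<le> f q \<or> f q \<le> c \<and> c \<le> f p"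
  obtains z where "p \<le> z" "z \<le> q" "f z = c"
  using IVT'[of f p c q] IVT2'[of f q c p] continuous_on_subset[OF assms(1), of "{p..q}"] assms
  by auto

lemma periodic_of_int:
  fixes h :: "real \<Rightarrow> 'a"
  assumes "\<And>t. h (t + 1) = h t"
  shows "h (t + of_int n) = h t"
proof (induction n rule: int_induct[where k = 0])
  case (step1 i)
  then show ?case using assms[of "t + of_int i"] by (simp add: add.assoc)
next
  case (step2 i)
  then show ?case using assms[of "t + of_int (i - 1)"] by (simp add: algebra_simps)
qed simp

text \<open>\<open>a + frac (t - a)\<close> is the integer translate of \<open>t\<close> in [a, a +
  1), so every value of a function of period 1 is found in a window starting at a chosen point,
  later the left end of an arc.\<close>

lemma periodic_representative:
  fixes h :: "real \<Rightarrow> 'a"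
  assumes "\<And>t. h (t + 1) = h t"
  shows "h (a + frac (t - a)) = h t"
  using periodic_of_int[of h t "- \<lfloor>t - a\<rfloor>", OF assms] by (simp add: frac_def)

lemma frac_bounds: "a \<le> a + frac (t - a)" "a + frac (t - a) < a + 1"
  by (auto simp: frac_ge_0 frac_lt_1)

lemma periodic_attains_sup:
  fixes h :: "real \<Rightarrow> real"
  assumes "continuous_on UNIV h" "\<And>t. h (t + 1) = h t"
  obtains p where "\<And>t. h t \<le> h p"
proof -
  have "continuous_on {0..1} h" using assms(1) continuous_on_subset by blast
  then obtain p where p: "\<And>t. 0 \<le> t \<Longrightarrow> t \<le> 1 \<Longrightarrow> h t \<le> h p"
    using continuous_attains_sup[of "{0..1::real}" h] by (auto simp: Ball_def)
  have "h t \<le> h p" for t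
    using p[of "0 + frac (t - 0)"] periodic_representative[of h 0 t, OF assms(2)]
      frac_bounds[of 0 t] by simp
  then show thesis using that by blast
qed

lemma periodic_attains_inf:
  fixes h :: "real \<Rightarrow> real"
  assumes "continuous_on UNIV h" "\<And>t. h (t + 1) = h t"
  obtains p where "\<And>t. h p \<le> h t"
  using periodic_attains_sup[of "\<lambda>t. - h t"] assms
  by (auto intro: continuous_on_minus)

text \<open>Global maxima and minima share one set, so that for a periodic \<open>f\<close> an arc
  free of it leaves both extreme values to the complementary arc.\<close>

definition extremal :: "(real \<Rightarrow> real) \<Rightarrow> real set" where
  "extremal f = {w. (\<forall>t. f t \<le> f w) \<or> (\<forall>t. f w \<le> f t)}"

text \<open>Closedness is what allows a first or last extreme point in a compact interval to be
  chosen.\<close>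

lemma closed_extremal:
  assumes "continuous_on UNIV f"
  shows "closed (extremal f)"
proof -
  have "extremal f = (\<Inter>t. {w. f t \<le> f w}) \<union> (\<Inter>t. {w. f w \<le> f t})"
    by (auto simp: extremal_def)
  also have "closed \<dots>"
    using assms by (intro closed_Un closed_INT ballI closed_Collect_le continuous_on_const)
  finally show ?thesis .
qed

lemma extremal_shift:
  assumes "\<And>t. f (t + 1) = f t" "w \<in> extremal f"
  shows "a + frac (w - a) \<in> extremal f"
  using assms(2) periodic_representative[of f a w, OF assms(1)] by (simp add: extremal_def)

text \<open>On an arc avoiding \<open>L\<close> with endpoints \<open>y\<close>, \<open>Y - 1\<close> in \<open>L\<close>, the function climbs from both
  endpoints to its maximum, so unequal endpoint values would force a further point of \<open>L\<close>.\<close>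

lemma gap_ends_eq_max:
  fixes f :: "real \<Rightarrow> real"
  assumes cont: "continuous_on UNIV f" and per: "\<And>t. f (t + 1) = f t"
    and sat: "\<And>s t. f s = f t \<Longrightarrow> s \<in> L \<Longrightarrow> t \<in> L"
    and avoid: "\<And>t. u \<le> t \<Longrightarrow> t \<le> v \<Longrightarrow> t \<notin> L"
    and bounds: "\<And>t. v \<le> t \<Longrightarrow> t \<le> u + 1 \<Longrightarrow> t \<in> L \<Longrightarrow> y \<le> t \<and> t \<le> Y"
    and y: "y \<in> L" "v \<le> y" and Y: "Y \<in> L" "Y \<le> u + 1" and "y \<le> Y"
    and w: "u \<le> w" "w \<le> v" "\<And>t. f t \<le> f w"
  shows "f y = f Y"
proof (rule linorder_cases[of "f y" "f Y"])
  assume less: "f y < f Y"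
  obtain z where z: "w \<le> z" "z \<le> y" "f z = f Y"
    using IVT_between[OF cont, of w y "f Y"] less w(2,3) y(2) by (metis order.strict_implies_order order_trans)
  then have "z \<in> L" using sat Y(1) by metis
  then show ?thesis
    using avoid[of z] bounds[of z] z w Y(2) \<open>y \<le> Y\<close> less by (cases "z \<le> v") auto
next
  assume less: "f Y < f y"
  have "f y \<le> f (w + 1)" using w(3) per by simp
  then obtain z where z: "Y \<le> z" "z \<le> w + 1" "f z = f y"
    using IVT_between[OF cont, of Y "w + 1" "f y"] less w(1) Y(2)
    by (metis add_le_cancel_right order.strict_implies_order order_trans)
  \<comment> \<open>\<open>z\<close> may lie beyond \<open>u + 1\<close>, where
    \<open>bounds\<close> says nothing; then \<open>z - 1\<close> lies in [u, v] and
    \<open>avoid\<close> applies to it instead.\<close>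
  have "f (z - 1) = f z" using per[of "z - 1"] by simp
  then have L: "z \<in> L" "z - 1 \<in> L" using sat y(1) z(3) by metis+
  show ?thesis
    using avoid[of "z - 1"] bounds[of z] z w L y(2) \<open>y \<le> Y\<close> less by (cases "z \<le> u + 1") auto
qed simp

text \<open>For a minimum at \<open>w\<close> the maximum case applies to \<open>- f\<close>:
  negation preserves the period and the level sets, so \<open>L\<close> stays saturated.\<close>

lemma gap_ends_eq:
  fixes f :: "real \<Rightarrow> real"
  assumes "continuous_on UNIV f" "\<And>t. f (t + 1) = f t"
    and "\<And>s t. f s = f t \<Longrightarrow> s \<in> L \<Longrightarrow> t \<in> L"
    and "\<And>t. u \<le> t \<Longrightarrow> t \<le> v \<Longrightarrow> t \<notin> L"
    and "\<And>t. v \<le> t \<Longrightarrow> t \<le> u + 1 \<Longrightarrow> t \<in> L \<Longrightarrow> y \<le> t \<and> t \<le> Y"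
    and "y \<in> L" "v \<le> y" and "Y \<in> L" "Y \<le> u + 1" and "y \<le> Y"
    and "u \<le> w" "w \<le> v" "w \<in> extremal f"
  shows "f y = f Y"
proof (cases "\<forall>t. f t \<le> f w")
  case True
  then show ?thesis using gap_ends_eq_max[of f L u v y Y w] assms by blast
next
  case False
  then have "\<forall>t. f w \<le> f t" using assms(13) by (auto simp: extremal_def)
  then have "- f t \<le> - f w" for t by simp
  moreover have "- f (t + 1) = - f t" for t using assms(2) by simp
  moreover have "t \<in> L" if "- f s = - f t" "s \<in> L" for s t using assms(3)[of s t] that by simp
  ultimately have "- f y = - f Y"
    by (rule gap_ends_eq_max[OF continuous_on_minus[OF assms(1)] _ _ assms(4-12), rotated -1])
  then show ?thesis by simp
qed

text \<open>A level set of \<open>x\<close> missing [u, v] would have a gap around this arc. The gap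
  contains extreme points of \<open>f\<close> and of \<open>g\<close>, and the level set is
  saturated for both, so both functions agree at the ends of the gap, against
  \<open>inj\<close>.\<close>

lemma between_extremal_full_range:
  fixes f g x :: "real \<Rightarrow> real"
  assumes f: "continuous_on UNIV f" "\<And>t. f (t + 1) = f t"
    and g: "continuous_on UNIV g" "\<And>t. g (t + 1) = g t"
    and x: "continuous_on UNIV x" "\<And>t. x (t + 1) = x t"
    and fx: "\<And>s t. f s = f t \<Longrightarrow> x s = x t" and gx: "\<And>s t. g s = g t \<Longrightarrow> x s = x t"
    and inj: "\<And>s t. s < t \<Longrightarrow> t < s + 1 \<Longrightarrow> f s = f t \<Longrightarrow> g s \<noteq> g t"
    and uv: "u \<le> v" "v \<le> u + 1" "u \<in> extremal f" "v \<in> extremal g"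
    and ab: "x a < x b"
  shows "{x a..x b} \<subseteq> x ` {u..v}"
proof -
  have inner: "c \<in> x ` {u..v}" if c: "x a < c" "c < x b" for c
  proof (rule ccontr)
    assume "c \<notin> x ` {u..v}"
    then have avoid: "x t \<noteq> c" if "u \<le> t" "t \<le> v" for t using that by auto
    define L where "L = {t. x t = c}"
    have same: "x u < c \<longleftrightarrow> x v < c"
      using IVT_between[OF x(1) uv(1), of c] avoid by (metis linorder_not_less nle_le order_less_imp_le)
    have nevc: "x u \<noteq> c" "x v \<noteq> c" using avoid uv by auto
    \<comment> \<open>\<open>x u\<close> and \<open>x v\<close> lie on the same side of
      \<open>c\<close>, and \<open>e\<close> is a point on the other side. Level points
      \<open>y1\<close> before and \<open>y2\<close> after \<open>e\<close> ensure that the gap has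
      two distinct ends.\<close>
    obtain e where e: "u \<le> e" "e < u + 1" "x u < c \<and> c < x e \<or> x e < c \<and> c < x u"
      using frac_bounds[of u] c nevc periodic_representative[of x u, OF x(2)]
      by (metis linorder_less_linear)
    have ve: "v \<le> e"
    proof (rule ccontr)
      assume "\<not> v \<le> e"
      then show False using IVT_between[OF x(1) e(1), of c] e avoid
        by (metis linorder_not_le order_less_imp_le order_trans)
    qed
    obtain y1 where y1: "v \<le> y1" "y1 \<le> e" "x y1 = c"
      using IVT_between[OF x(1) ve, of c] e(3) same nevc by (metis linorder_less_linear order_less_imp_le order_less_asym)
    obtain y2 where y2: "e \<le> y2" "y2 \<le> u + 1" "x y2 = c"
      using IVT_between[OF x(1), of e "u + 1" c] e x(2)[of u] by (metis order_less_imp_le)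
    have "y1 < y2" using y1 y2 e(3) by (cases "y1 = y2") auto
    have "closed L" unfolding L_def using x(1) by (intro closed_Collect_eq continuous_on_const)
    then have K: "compact ({v..u + 1} \<inter> L)" by (intro compact_Int_closed) auto
    have y12: "y1 \<in> {v..u + 1} \<inter> L" "y2 \<in> {v..u + 1} \<inter> L"
      using y1 y2 e by (auto simp: L_def)
    obtain y where y: "y \<in> {v..u + 1} \<inter> L" "\<forall>t\<in>{v..u + 1} \<inter> L. y \<le> t"
      using compact_attains_inf[OF K] y12 by blast
    obtain Y where Y: "Y \<in> {v..u + 1} \<inter> L" "\<forall>t\<in>{v..u + 1} \<inter> L. t \<le> Y"
      using compact_attains_sup[OF K] y12 by blast
    have "y < Y" using y(2)[rule_format, OF y12(1)] Y(2)[rule_format, OF y12(2)] \<open>y1 < y2\<close> by linarith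
    \<comment> \<open>From \<open>v < y\<close> and \<open>Y \<le> u + 1 \<le> v + 1\<close> the two
      ends are less than a period apart, as \<open>inj\<close> requires.\<close>
    have "y \<noteq> v" using y nevc by (auto simp: L_def)
    then have "Y < y + 1" using y Y uv by auto
    have noL: "t \<notin> L" if "u \<le> t" "t \<le> v" for t using avoid that by (simp add: L_def)
    have bd: "y \<le> t \<and> t \<le> Y" if "v \<le> t" "t \<le> u + 1" "t \<in> L" for t using y Y that by auto
    have yY: "y \<in> L" "v \<le> y" "Y \<in> L" "Y \<le> u + 1" "y \<le> Y" using y Y \<open>y < Y\<close> by auto
    have satf: "t \<in> L" if "f s = f t" "s \<in> L" for s t using fx[OF that(1)] that(2) by (simp add: L_def)
    have satg: "t \<in> L" if "g s = g t" "s \<in> L" for s t using gx[OF that(1)] that(2) by (simp add: L_def)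
    have "f y = f Y"
      by (rule gap_ends_eq[OF f satf noL bd yY order_refl uv(1,3)])
    moreover have "g y = g Y"
      by (rule gap_ends_eq[OF g satg noL bd yY uv(1) order_refl uv(4)])
    ultimately show False using inj \<open>y < Y\<close> \<open>Y < y + 1\<close> by blast
  qed
  \<comment> \<open>Only levels strictly between \<open>x a\<close> and \<open>x b\<close> are
    covered so far; the two end values follow by closure, the image of the arc being
    compact.\<close>
  have cl: "closed (x ` {u..v})"
    using compact_continuous_image[of "{u..v}" x] continuous_on_subset[OF x(1)]
    by (auto intro: compact_imp_closed)
  have "closure {x a<..<x b} \<subseteq> x ` {u..v}"
    using inner cl by (intro closure_minimal) auto
  then show ?thesis using ab by simp
qed

section \<open>Interleaving of extreme points\<close>

text \<open>The planar curve (f, x) joins the left and right sides of its bounding box within (v, u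
  + 1), and bottom and top within [u, v]. By Fashoda the two pieces meet, at parameters with
  \<open>s < t < s + 1\<close>, against injectivity.\<close>

lemma no_separated_extremes:
  fixes f x :: "real \<Rightarrow> real"
  assumes f: "continuous_on UNIV f" and x: "continuous_on UNIV x"
    and inj: "\<And>s t. s < t \<Longrightarrow> t < s + 1 \<Longrightarrow> f s = f t \<Longrightarrow> x s \<noteq> x t"
    and p: "v < p" "p < u + 1" "\<And>t. f p \<le> f t" and q: "v < q" "q < u + 1" "\<And>t. f t \<le> f q"
    and S: "S \<in> {u..v}" "\<And>t. x S \<le> x t" and T: "T \<in> {u..v}" "\<And>t. x t \<le> x T"
  shows False
proof -
  define h :: "real \<Rightarrow> real ^ 2" where "h t = (\<chi> i. if i = 1 then f t else x t)" for t
  \<comment> \<open>Runs from \<open>h a\<close> to \<open>h b\<close> over [0, 1]. The case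
    \<open>a > b\<close> is allowed, since the order of \<open>p\<close>, \<open>q\<close> and of
    \<open>S\<close>, \<open>T\<close> is unknown.\<close>
  define seg where "seg a b = (\<lambda>t. h (a + t * (b - a)))" for a b
  have h: "continuous_on UNIV h"
    unfolding h_def
  proof (intro continuous_on_vec_lambda)
    fix i :: 2
    show "continuous_on UNIV (\<lambda>t. if i = 1 then f t else x t)"
      using f x by (cases "i = 1") auto
  qed
  have h_comp: "h t $ 1 = f t" "h t $ 2 = x t" for t by (simp_all add: h_def)
  have path: "path (seg a b)" for a b
    unfolding path_def seg_def
    by (intro continuous_on_compose2[OF h] continuous_intros) auto
  have in_seg: "\<exists>t. min a b \<le> t \<and> t \<le> max a b \<and> z = h t" if z: "z \<in> path_image (seg a b)" for a b z
  proof -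
    obtain t where t: "0 \<le> t" "t \<le> 1" "z = h (a + t * (b - a))"
      using z unfolding path_image_def seg_def by fastforce
    have "min a b \<le> (1 - t) * a + t * b" "(1 - t) * a + t * b \<le> max a b"
      using t convex_bound_le[of a "max a b" b "1 - t" t]
        convex_bound_le[of "- a" "- min a b" "- b" "1 - t" t] by auto
    then show ?thesis using t(3) by (intro exI[of _ "a + t * (b - a)"]) (auto simp: algebra_simps)
  qed
  have box: "path_image (seg a b) \<subseteq> cbox (vector [f p, x S]) (vector [f q, x T])" for a b
    using p(3) q(3) S(2) T(2)
    by (auto simp: path_image_def seg_def h_comp mem_box_cart forall_2)
  obtain z where z: "z \<in> path_image (seg p q)" "z \<in> path_image (seg S T)"
    by (rule fashoda[OF path[of p q] path[of S T] box box])
      (auto simp: seg_def h_comp pathstart_def pathfinish_def)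
  obtain t where t: "v < t" "t < u + 1" "z = h t"
    using in_seg[OF z(1)] p q by (metis (no_types) min_def max_def order_le_less_trans order_less_le_trans)
  obtain s where s: "u \<le> s" "s \<le> v" "z = h s"
    using in_seg[OF z(2)] S(1) T(1) by (metis (no_types) atLeastAtMost_iff min_def max_def order_trans)
  have "f s = f t" "x s = x t"
    using s(3) t(3) by (metis h_comp)+
  then show False using inj[of s t] s t by linarith
qed

text \<open>Here \<open>f i\<close> stands for the position on the shadow in direction \<open>i\<close> and \<open>x i\<close> for the
  coordinate along direction \<open>i\<close>.\<close>

locale three_arc_shadows =
  fixes I :: "'i set" and f x :: "'i \<Rightarrow> real \<Rightarrow> real"
  assumes card_I: "card I = 3"
    and cont_f: "i \<in> I \<Longrightarrow> continuous_on UNIV (f i)"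
    and cont_x: "i \<in> I \<Longrightarrow> continuous_on UNIV (x i)"
    and per_f: "i \<in> I \<Longrightarrow> f i (t + 1) = f i t"
    and per_x: "i \<in> I \<Longrightarrow> x i (t + 1) = x i t"
    and factor: "i \<in> I \<Longrightarrow> j \<in> I \<Longrightarrow> i \<noteq> j \<Longrightarrow> f j s = f j t \<Longrightarrow> x i s = x i t"
    and inj_ff: "i \<in> I \<Longrightarrow> j \<in> I \<Longrightarrow> i \<noteq> j \<Longrightarrow> s < t \<Longrightarrow> t < s + 1 \<Longrightarrow> f i s = f i t \<Longrightarrow> f j s \<noteq> f j t"
    and inj_fx: "i \<in> I \<Longrightarrow> s < t \<Longrightarrow> t < s + 1 \<Longrightarrow> f i s = f i t \<Longrightarrow> x i s \<noteq> x i t"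
begin

text \<open>If \<open>x i\<close> were constant, \<open>f i\<close> would be injective within each
  period. But the mean of its values at 0 and 1/2 is attained inside both halves of [0, 1].\<close>

lemma x_not_constant:
  assumes i: "i \<in> I"
  obtains a b where "x i a < x i b"
proof -
  have "\<exists>a b. x i a \<noteq> x i b"
  proof (rule ccontr)
    assume "\<nexists>a b. x i a \<noteq> x i b"
    then have inj: "f i s \<noteq> f i t" if "s < t" "t < s + 1" for s t
      using inj_fx[OF i, of s t] that by blast
    define m where "m = (f i 0 + f i (1/2)) / 2"
    have ne: "f i 0 \<noteq> f i (1/2)" using inj[of 0 "1/2"] by simp
    have 1: "f i 1 = f i 0" using per_f[OF i, of 0] by simp
    obtain s where s: "0 \<le> s" "s \<le> 1/2" "f i s = m"
      by (rule IVT_between[OF cont_f[OF i], of 0 "1/2" m]) (auto simp: m_def)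
    obtain t where t: "1/2 \<le> t" "t \<le> 1" "f i t = m"
      by (rule IVT_between[OF cont_f[OF i], of "1/2" 1 m]) (auto simp: m_def 1)
    have "m \<noteq> f i 0" "m \<noteq> f i (1/2)" using ne by (auto simp: m_def)
    then have "s \<noteq> 0" "s \<noteq> 1/2" using s(3) by metis+
    then show False using inj[of s t] s t by auto
  qed
  then show thesis using that by (metis linorder_neqE)
qed

lemma third:
  assumes "j \<in> I" "k \<in> I" "j \<noteq> k"
  obtains i where "I = {i, j, k}" "i \<noteq> j" "i \<noteq> k"
proof -
  have "card (I - {j, k}) = 1" using assms card_I by (simp add: card_Diff_subset)
  then obtain i where "I - {j, k} = {i}" by (auto simp: card_Suc_eq numeral_eq_Suc)
  then show thesis using that[of i] assms by auto
qed

lemma full_range: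
  assumes "I = {i, j, k}" "i \<noteq> j" "i \<noteq> k" "j \<noteq> k"
    and "u \<le> v" "v \<le> u + 1" "u \<in> extremal (f j)" "v \<in> extremal (f k)" "x i a < x i b"
  shows "{x i a..x i b} \<subseteq> x i ` {u..v}"
proof -
  have I: "i \<in> I" "j \<in> I" "k \<in> I" using assms(1) by auto
  show ?thesis
    by (rule between_extremal_full_range[OF cont_f[OF I(2)] per_f[OF I(2)] cont_f[OF I(3)] per_f[OF I(3)]
          cont_x[OF I(1)] per_x[OF I(1)] factor[OF I(1,2) assms(2)] factor[OF I(1,3) assms(3)]
          inj_ff[OF I(2,3) assms(4)] assms(5-9)])
qed

text \<open>A common extreme point is an arc of length zero to which \<open>full_range\<close>
  applies, so the third coordinate would take a single value.\<close>

lemma extremal_disjoint: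
  assumes "j \<in> I" "k \<in> I" "j \<noteq> k"
  shows "extremal (f j) \<inter> extremal (f k) = {}"
proof (rule ccontr)
  assume "extremal (f j) \<inter> extremal (f k) \<noteq> {}"
  then obtain w where w: "w \<in> extremal (f j)" "w \<in> extremal (f k)" by blast
  obtain i where i: "I = {i, j, k}" "i \<noteq> j" "i \<noteq> k" using third[OF assms] .
  obtain a b where ab: "x i a < x i b" using x_not_constant[of i] i by blast
  have "{x i a..x i b} \<subseteq> {x i w}"
    using full_range[OF i assms(3), of w w a b] w ab by simp
  moreover have "x i a \<in> {x i a..x i b}" "x i b \<in> {x i a..x i b}" using ab by auto
  ultimately show False using ab by (metis order_less_irrefl singletonD subsetD)
qed

text \<open>Otherwise [u, v] carries both extremes of \<open>x i\<close> by
  \<open>full_range\<close>, while both extremes of \<open>f i\<close> have translates in (v, u +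
  1); \<open>no_separated_extremes\<close> excludes this.\<close>

lemma extremal_between:
  assumes "I = {i, j, k}" "i \<noteq> j" "i \<noteq> k" "j \<noteq> k"
    and uv: "u \<le> v" "v \<le> u + 1" "u \<in> extremal (f j)" "v \<in> extremal (f k)"
  shows "extremal (f i) \<inter> {u..v} \<noteq> {}"
proof
  assume empty: "extremal (f i) \<inter> {u..v} = {}"
  have i: "i \<in> I" using assms by simp
  obtain S where S: "\<And>t. x i S \<le> x i t"
    using periodic_attains_inf[OF cont_x[OF i] per_x[OF i]] by blast
  obtain T where T: "\<And>t. x i t \<le> x i T"
    using periodic_attains_sup[OF cont_x[OF i] per_x[OF i]] by blast
  obtain a b where "x i a < x i b" using x_not_constant[OF i] .
  then have ST: "x i S < x i T" using S[of a] T[of b] by linarith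
  have sub: "{x i S..x i T} \<subseteq> x i ` {u..v}" using full_range[OF assms ST] .
  have "x i S \<in> x i ` {u..v}" "x i T \<in> x i ` {u..v}"
    using sub ST by auto
  then obtain S' T' where S': "S' \<in> {u..v}" "x i S = x i S'" and T': "T' \<in> {u..v}" "x i T = x i T'"
    by blast
  have rep: "\<exists>q. v < q \<and> q < u + 1 \<and> f i q = f i p" if "p \<in> extremal (f i)" for p
  proof -
    have "u + frac (p - u) \<in> extremal (f i)" using extremal_shift[of "f i", OF per_f[OF i] that] .
    then have "u + frac (p - u) \<notin> {u..v}" using empty by blast
    then show ?thesis
      using frac_bounds[of u p] periodic_representative[of "f i" u p, OF per_f[OF i]]
      by (intro exI[of _ "u + frac (p - u)"]) auto
  qed
  obtain p where p: "\<And>t. f i p \<le> f i t"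
    using periodic_attains_inf[OF cont_f[OF i] per_f[OF i]] by blast
  then have "p \<in> extremal (f i)" by (simp add: extremal_def)
  then obtain p' where p': "v < p'" "p' < u + 1" "f i p' = f i p" using rep by blast
  obtain q where q: "\<And>t. f i t \<le> f i q"
    using periodic_attains_sup[OF cont_f[OF i] per_f[OF i]] by blast
  then have "q \<in> extremal (f i)" by (simp add: extremal_def)
  then obtain q' where q': "v < q'" "q' < u + 1" "f i q' = f i q" using rep by blast
  show False
    by (rule no_separated_extremes[OF cont_f[OF i] cont_x[OF i] inj_fx[OF i] p'(1,2) _ q'(1,2) _ S'(1) _ T'(1)])
      (use p p' q q' S S' T T' in simp_all)
qed

lemma extremal_nonempty:
  assumes "i \<in> I"
  obtains w where "w \<in> extremal (f i)"
proof -
  obtain w where "\<And>t. f i t \<le> f i w"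
    using periodic_attains_sup[OF cont_f[OF assms] per_f[OF assms]] by blast
  then show thesis using that[of w] by (simp add: extremal_def)
qed

lemma contradiction: False
proof -
  obtain a b c where abc: "I = {a, b, c}" "a \<noteq> b" "a \<noteq> c" "b \<noteq> c"
    using card_I unfolding card_3_iff by blast
  obtain u0 where u0: "u0 \<in> extremal (f a)" using extremal_nonempty abc by blast
  define E where "E = extremal (f b) \<union> extremal (f c)"
  obtain w where w: "w \<in> extremal (f b)" using extremal_nonempty abc by blast
  have "u0 + frac (w - u0) \<in> {u0..u0 + 1} \<inter> E"
    using extremal_shift[of "f b", OF per_f w, of u0] frac_bounds[of u0 w] abc by (auto simp: E_def)
  moreover have "compact ({u0..u0 + 1} \<inter> E)"
    unfolding E_def using abc by (intro compact_Int_closed closed_Un closed_extremal cont_f) auto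
  \<comment> \<open>\<open>v\<close> is the first point of \<open>E\<close> from \<open>u0\<close>
    on, so [u0, v] meets \<open>E\<close> only in \<open>v\<close>.\<close>
  ultimately obtain v where v: "v \<in> {u0..u0 + 1} \<inter> E" "\<forall>t\<in>{u0..u0 + 1} \<inter> E. v \<le> t"
    using compact_attains_inf by blast
  have "compact ({u0..v} \<inter> extremal (f a))"
    using abc by (intro compact_Int_closed closed_extremal cont_f) auto
  moreover have "u0 \<in> {u0..v} \<inter> extremal (f a)" using u0 v by auto
  ultimately obtain u where u: "u \<in> {u0..v} \<inter> extremal (f a)" "\<forall>t\<in>{u0..v} \<inter> extremal (f a). t \<le> u"
    using compact_attains_sup by blast
  \<comment> \<open>\<open>k\<close> is whichever of \<open>b\<close>, \<open>c\<close> has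
    \<open>v\<close> as an extreme point, and \<open>i\<close> is the other.
    \<open>extremal_between\<close> gives an extreme point of \<open>f i\<close> in [u, v]; it can
    only be \<open>v\<close>, which \<open>extremal_disjoint\<close> forbids.\<close>
  have False if i: "I = {i, a, k}" "i \<noteq> a" "i \<noteq> k" "a \<noteq> k" "v \<in> extremal (f k)"
    and E: "E = extremal (f i) \<union> extremal (f k)" for i k
  proof -
    obtain t where t: "t \<in> extremal (f i)" "u \<le> t" "t \<le> v"
      using extremal_between[OF i(1-4), of u v] i(5) u v by auto
    then have "t = v" using u v E by (intro antisym) auto
    then show False using extremal_disjoint[of i k] t i by auto
  qed
  from this[of b c] this[of c b] show False using v abc by (auto simp: E_def)
qed

end

section \<open>Shadows of a closed curve\<close>

text \<open>The inverse \<open>k\<close> of the arc parametrization turns a shadow point into its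
  position along the arc; being injective on the arc, it keeps the fibres of the projected
  curve.\<close>

lemma shadow_parameter:
  fixes \<gamma> :: "real \<Rightarrow> 'a::euclidean_space" and P :: "'a \<Rightarrow> 'a"
  assumes "is_simple_path (P ` C)" "continuous_on UNIV P" "continuous_on UNIV \<gamma>" "range \<gamma> \<subseteq> C"
  obtains f :: "real \<Rightarrow> real" where "continuous_on UNIV f" "\<And>s t. f s = f t \<longleftrightarrow> P (\<gamma> s) = P (\<gamma> t)"
proof -
  obtain g where g: "arc g" "P ` C = path_image g" using assms(1) by (auto simp: is_simple_path_def)
  obtain k where k: "homeomorphism {0..1} (path_image g) g k" using homeomorphism_arc[OF g(1)] .
  have mem: "P (\<gamma> t) \<in> path_image g" for t using assms(4) g(2) by blast
  have "continuous_on UNIV (\<lambda>t. P (\<gamma> t))"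
    by (rule continuous_on_compose2[OF assms(2,3)]) simp
  moreover have "continuous_on (path_image g) k" using k by (simp add: homeomorphism_def)
  moreover have "(\<lambda>t. P (\<gamma> t)) ` UNIV \<subseteq> path_image g" using mem by blast
  ultimately have "continuous_on UNIV (\<lambda>t. k (P (\<gamma> t)))" by (metis continuous_on_compose2)
  moreover have "k (P (\<gamma> s)) = k (P (\<gamma> t)) \<longleftrightarrow> P (\<gamma> s) = P (\<gamma> t)" for s t
    using k mem[of s] mem[of t] by (metis homeomorphism_apply2)
  ultimately show thesis using that by blast
qed

lemma closed_curve_periodic_parametrization:
  fixes C :: "'a::topological_space set"
  assumes "simple_closed_curve C"
  obtains \<gamma> :: "real \<Rightarrow> 'a" where "continuous_on UNIV \<gamma>" "range \<gamma> \<subseteq> C" "\<And>t. \<gamma> (t + 1) = \<gamma> t"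
    "\<And>s t. s < t \<Longrightarrow> t < s + 1 \<Longrightarrow> \<gamma> s \<noteq> \<gamma> t"
proof -
  obtain g :: "complex \<Rightarrow> 'a" where g: "continuous_on (sphere 0 1) g" "inj_on g (sphere 0 1)"
    "C = g ` sphere 0 1" using assms by (auto simp: simple_closed_curve_def)
  define e where "e t = cis (2 * pi * t)" for t
  have e: "e t \<in> sphere 0 1" for t by (simp add: e_def)
  have "e (t + 1) = e t" for t
    by (simp add: e_def distrib_left flip: cis_mult)
  moreover have "e s \<noteq> e t" if "s < t" "t < s + 1" for s t
  proof
    assume "e s = e t"
    then have "exp (\<i> * complex_of_real (2 * pi * s)) = exp (\<i> * complex_of_real (2 * pi * t))"
      by (simp only: e_def cis_conv_exp)
    \<comment> \<open>\<open>exp\<close> separates distinct numbers whose imaginary parts differ by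
      less than 2 pi; this is where \<open>t < s + 1\<close> enters.\<close>
    moreover have "\<bar>2 * pi * s - 2 * pi * t\<bar> < 2 * pi"
      using that mult_strict_left_mono[of t "s + 1" "2 * pi"]
      by (simp add: abs_if distrib_left)
    then have "\<bar>Im (\<i> * complex_of_real (2 * pi * s)) - Im (\<i> * complex_of_real (2 * pi * t))\<bar> < 2 * pi"
      by (simp only: Im_i_times Re_complex_of_real)
    ultimately have "\<i> * complex_of_real (2 * pi * s) = \<i> * complex_of_real (2 * pi * t)"
      using exp_complex_eqI by blast
    then have "2 * pi * s = 2 * pi * t" by (metis complex_i_not_zero mult_left_cancel of_real_eq_iff)
    then show False using that(1) pi_gt_zero by simp
  qed
  moreover have "continuous_on UNIV (\<lambda>t. g (e t))"
    by (intro continuous_on_compose2[OF g(1)]) (auto simp: e_def intro!: continuous_intros)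
  moreover have "range (\<lambda>t. g (e t)) \<subseteq> C" using e g(3) by blast
  ultimately show thesis
    using that[of "\<lambda>t. g (e t)"] e inj_onD[OF g(2)] by metis
qed

lemma not_three_independent_arc_shadows:
  fixes C :: "'a::euclidean_space set"
  assumes C: "simple_closed_curve C" and V: "independent V" "card V = 3"
    and arcs: "\<And>v. v \<in> V \<Longrightarrow> is_simple_path (orth_proj (orthogonal_comp {v}) ` C)"
  shows False
proof -
  obtain \<gamma> :: "real \<Rightarrow> 'a" where \<gamma>: "continuous_on UNIV \<gamma>" "range \<gamma> \<subseteq> C" "\<And>t. \<gamma> (t + 1) = \<gamma> t"
    "\<And>s t. s < t \<Longrightarrow> t < s + 1 \<Longrightarrow> \<gamma> s \<noteq> \<gamma> t"
    by (rule closed_curve_periodic_parametrization[OF C]) (rule that)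
  define P where "P v = orth_proj (orthogonal_comp {v})" for v :: 'a
  have nz: "v \<noteq> 0" if "v \<in> V" for v using V(1) that dependent_zero by blast
  have P: "P v y = y - ((y \<bullet> v) / (v \<bullet> v)) *\<^sub>R v" if "v \<in> V" for v y
    using orth_proj_hyperplane[OF nz[OF that]] by (simp add: P_def)
  have contP: "continuous_on UNIV (P v)" if "v \<in> V" for v
  proof -
    have "P v = (\<lambda>y. y - ((y \<bullet> v) / (v \<bullet> v)) *\<^sub>R v)" using P[OF that] by blast
    then show ?thesis using nz[OF that] by (auto intro!: continuous_intros)
  qed
  have diff: "\<exists>c. y - z = c *\<^sub>R v" if "v \<in> V" "P v y = P v z" for v y z
    using that(2) unfolding P[OF that(1)]
    by (intro exI[of _ "(y \<bullet> v) / (v \<bullet> v) - (z \<bullet> v) / (v \<bullet> v)"]) (simp add: algebra_simps)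
  have "\<exists>f :: real \<Rightarrow> real. continuous_on UNIV f \<and> (\<forall>s t. f s = f t \<longleftrightarrow> P v (\<gamma> s) = P v (\<gamma> t))"
    if "v \<in> V" for v
    using shadow_parameter[of "P v" C \<gamma>] arcs[OF that] contP[OF that] \<gamma>(1,2) by (metis P_def)
  then obtain f :: "'a \<Rightarrow> real \<Rightarrow> real" where f: "\<And>v. v \<in> V \<Longrightarrow> continuous_on UNIV (f v)"
    "\<And>v s t. v \<in> V \<Longrightarrow> f v s = f v t \<longleftrightarrow> P v (\<gamma> s) = P v (\<gamma> t)" by metis
  \<comment> \<open>The functionals dual to \<open>V\<close> serve as coordinates. Since
    \<open>V\<close> may fail to be orthogonal, inner products with its members would not do:
    \<open>\<phi> w\<close> has to be constant along every other \<open>v\<close>.\<close>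
  have "\<exists>\<phi> :: 'a \<Rightarrow> real. linear \<phi> \<and> (\<forall>w\<in>V. \<phi> w = (if w = v then 1 else 0))" for v
    by (rule linear_independent_extend[OF V(1)])
  then obtain \<phi> :: "'a \<Rightarrow> 'a \<Rightarrow> real" where \<phi>: "\<And>v. linear (\<phi> v)"
    "\<And>v w. w \<in> V \<Longrightarrow> \<phi> v w = (if w = v then 1 else 0)" by metis
  have fib: "\<exists>c. \<gamma> s - \<gamma> t = c *\<^sub>R v" if "v \<in> V" "f v s = f v t" for v s t
    using diff f(2) that by blast
  \<comment> \<open>Points with the same shadow differ by \<open>c *\<^sub>R v\<close>. For
    \<open>w \<noteq> v\<close> the functional \<open>\<phi> w\<close> kills this difference; in the
    next fact \<open>\<phi> v\<close> returns \<open>c\<close> itself, forcing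
    \<open>c = 0\<close>.\<close>
  have \<phi>_fib: "\<phi> w (\<gamma> s) = \<phi> w (\<gamma> t)" if v: "v \<in> V" "v \<noteq> w" "f v s = f v t" for v w s t
  proof -
    obtain c where "\<gamma> s - \<gamma> t = c *\<^sub>R v" using fib[OF v(1,3)] by blast
    then have "\<phi> w (\<gamma> s) - \<phi> w (\<gamma> t) = c * \<phi> w v"
      by (metis \<phi>(1) linear_diff linear_scale real_scaleR_def)
    then show ?thesis using \<phi>(2)[OF v(1)] v(2) by simp
  qed
  have \<phi>_inj: "\<gamma> s = \<gamma> t" if v: "v \<in> V" "f v s = f v t" "\<phi> v (\<gamma> s) = \<phi> v (\<gamma> t)" for v s t
  proof -
    obtain c where c: "\<gamma> s - \<gamma> t = c *\<^sub>R v" using fib[OF v(1,2)] by blast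
    then have "\<phi> v (\<gamma> s) - \<phi> v (\<gamma> t) = c * \<phi> v v"
      by (metis \<phi>(1) linear_diff linear_scale real_scaleR_def)
    then show ?thesis using \<phi>(2)[OF v(1)] v(3) c by simp
  qed
  interpret three_arc_shadows V f "\<lambda>v t. \<phi> v (\<gamma> t)"
  proof
    fix v :: 'a
    show "continuous_on UNIV (\<lambda>t. \<phi> v (\<gamma> t))"
      using \<phi>(1) \<gamma>(1) by (simp add: linear_continuous_on_compose)
  next
    fix v s t
    assume "v \<in> V" "s < t" "t < s + 1" "f v s = f v t"
    then show "\<phi> v (\<gamma> s) \<noteq> \<phi> v (\<gamma> t)" using \<phi>_inj \<gamma>(4) by metis
  next
    fix v w s t
    assume vw: "v \<in> V" "w \<in> V" "v \<noteq> w" and st: "s < t" "t < s + 1" and v: "f v s = f v t"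
    \<comment> \<open>Agreement of \<open>f w\<close> would fix the coordinate along
      \<open>v\<close>, and together with agreement of \<open>f v\<close> that makes the two curve
      points equal.\<close>
    have "\<phi> v (\<gamma> s) = \<phi> v (\<gamma> t)" if "f w s = f w t" using \<phi>_fib vw that by metis
    then show "f w s \<noteq> f w t" using \<phi>_inj[OF vw(1) v] \<gamma>(4)[OF st] by metis
  next
    fix v w s t
    assume "v \<in> V" "w \<in> V" "v \<noteq> w" "f w s = f w t"
    then show "\<phi> v (\<gamma> s) = \<phi> v (\<gamma> t)" using \<phi>_fib by metis
  qed (simp_all add: V(2) f \<gamma>(3))
  show False by (rule contradiction)
qed

section \<open>Coordinate shadows as projections along axis vectors\<close>

lemma coord_proj_eq_orth_proj:
  fixes i :: "'n::finite"
  shows "coord_proj i = orth_proj (orthogonal_comp {axis i 1})"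
proof -
  have "{x :: real ^ 'n. x $ i = 0} = orthogonal_comp {axis i 1}"
    by (auto simp: orthogonal_comp_def orthogonal_def inner_axis inner_commute)
  then show ?thesis by (simp add: coord_proj_def)
qed

theorem theorem1:
  fixes C :: "(real ^ 'n) set"
  assumes "simple_closed_curve C"
  shows "card {i. is_simple_path (coord_proj i ` C)} \<le> 2 \<and>
    \<not> (\<exists>v\<^sub>1 v\<^sub>2 v\<^sub>3 :: real ^ 'n. distinct [v\<^sub>1, v\<^sub>2, v\<^sub>3] \<and> independent {v\<^sub>1, v\<^sub>2, v\<^sub>3} \<and>
        (\<forall>v \<in> {v\<^sub>1, v\<^sub>2, v\<^sub>3}. is_simple_path (orth_proj (orthogonal_comp {v}) ` C)))"
proof (intro conjI notI)
  show "card {i. is_simple_path (coord_proj i ` C)} \<le> 2"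
  proof (rule ccontr)
    assume "\<not> ?thesis"
    then obtain J where J: "J \<subseteq> {i. is_simple_path (coord_proj i ` C)}" "card J = 3"
      using obtain_subset_with_card_n[of 3] by (metis not_less_eq_eq numeral_2_eq_2 numeral_3_eq_3)
    \<comment> \<open>Three offending indices give three members of the standard basis, which
      reduces the count to the case of independent directions.\<close>
    let ?V = "(\<lambda>i. axis i 1 :: real ^ 'n) ` J"
    have "card ?V = 3" using J(2) by (subst card_image) (auto simp: inj_on_def axis_eq_axis)
    moreover have "independent ?V"
      by (rule independent_mono[OF independent_Basis]) (auto simp: Basis_vec_def)
    moreover have "is_simple_path (orth_proj (orthogonal_comp {v}) ` C)" if "v \<in> ?V" for v
      using that J(1) by (auto simp: coord_proj_eq_orth_proj)
    ultimately show False using not_three_independent_arc_shadows[OF assms] by blast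
  qed
next
  assume "\<exists>v\<^sub>1 v\<^sub>2 v\<^sub>3 :: real ^ 'n. distinct [v\<^sub>1, v\<^sub>2, v\<^sub>3] \<and> independent {v\<^sub>1, v\<^sub>2, v\<^sub>3} \<and>
        (\<forall>v \<in> {v\<^sub>1, v\<^sub>2, v\<^sub>3}. is_simple_path (orth_proj (orthogonal_comp {v}) ` C))"
  then obtain v\<^sub>1 v\<^sub>2 v\<^sub>3 :: "real ^ 'n" where v: "distinct [v\<^sub>1, v\<^sub>2, v\<^sub>3]" "independent {v\<^sub>1, v\<^sub>2, v\<^sub>3}"
    "\<forall>v \<in> {v\<^sub>1, v\<^sub>2, v\<^sub>3}. is_simple_path (orth_proj (orthogonal_comp {v}) ` C)" by blast
  have "card {v\<^sub>1, v\<^sub>2, v\<^sub>3} = 3" using v(1) by simp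
  then show False using not_three_independent_arc_shadows[OF assms v(2)] v(3) by blast
qed

end
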